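(* Let $(X,d)$ be a geodesic $\delta$-hyperbolic metric space, $\delta\ge 0$. Let $(Z_i)_{i\ge 1}$ be a sequence of independent, identically distributed random variables on a probability space taking values in $X$ with distribution $\mu\in\mathcal{P}(X)$, and take $p\in\mathcal{B}(\mu,0)$. Given $\tau>0$ and an arbitrary initial point $S_0\in X$, we define a sequence $(S_k)_{k\ge 0}$ in $X$ recursively by \[ S_{k+1}\in\mathsf{J}^{f_k}_\tau(S_k),\qquad f_k:=d^2(Z_{k+1},\cdot). \] Assume that $p$, $\operatorname{supp}\mu$ and $(S_k)_{k\ge 0}$ are all included in a bounded set $\Omega\subset X$. Then, for any $\varepsilon>0$, we have \[ \mathbb{E}\big[d^2(p,S_{k_0})\big]\le 8D_\Omega^2\tau+(\Theta_\Omega+16D_\Omega+16\delta)\delta+\varepsilon \] for some $k_0<d^2(p,S_0)/(\tau\varepsilon)$, where $D_\Omega:=\operatorname{diam}(\Omega)$ and \[ \Theta_\Omega:=\max\left\{8D_\Omega+8\delta,\ (4+8\tau)D_\Omega\,\min\left\{\frac1\tau,\frac{2D_\Omega}{\delta}\right\}\right\}. \]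
   Context: A metric space $(X,d)$ is $\delta$-hyperbolic if $(x|z)_p\ge\min\{(x|y)_p,(y|z)_p\}-\delta$ for all $p,x,y,z\in X$, where $(x|y)_p:=\frac12\{d(p,x)+d(p,y)-d(x,y)\}$. It is geodesic if any two points $x,y$ are joined by a minimal geodesic $\gamma:[0,1]\to X$, i.e. $\gamma(0)=x$, $\gamma(1)=y$ and $d(\gamma(s),\gamma(t))=|s-t|\,d(x,y)$ for all $s,t\in[0,1]$. $\mathcal{P}(X)$ is the set of Borel probability measures on $X$; $d^2(x,y)$ means $d(x,y)^2$; $\operatorname{diam}$ is the diameter with respect to $d$; $\mathbb{E}$ denotes expectation. For $\mu$ of finite first moment (in particular of bounded support), $\mathcal{B}(\mu,0)$ is the set of barycenters of $\mu$, i.e. of points $x\in X$ with \[ \int_X\{d^2(x,z)-d^2(x_0,z)\}\,\mu(dz)\le\inf_{y\in X}\int_X\{d^2(y,z)-d^2(x_0,z)\}\,\mu(dz), \] where $x_0\in X$ is a fixed point; the set does not depend on the choice of $x_0$. For $g:X\to\mathbb{R}$, $\tau>0$ and $x\in X$, the proximal operator is the set-valued map \[ \mathsf{J}^g_\tau(x):=\operatorname*{arg\,min}_{y\in X}\left\{g(y)+\frac{d^2(x,y)}{2\tau}\right\}, \] i.e. the set of all $y\in X$ attaining the minimum. For $g=d^2(z,\cdot)$, each $y\in\mathsf{J}^g_\tau(x)$ is given as $y=\gamma((2\tau+1)^{-1})$ for some minimal geodesic $\gamma:[0,1]\to X$ from $z$ to $x$.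
   Formalization: If S_0 = p, no k_0 < 0 exists, so k_0 = 0 is allowed there; μ is assumed concentrated on supp μ (automatic for separable X); each S_k is assumed measurable with respect to σ(Z_1,…,Z_k), making the expectation meaningful and the choice of minimizers non-anticipating. *)

theory Defs
  imports "HOL-Probability.Probability"
begin

definition gromov_product :: "'a::metric_space \<Rightarrow> 'a \<Rightarrow> 'a \<Rightarrow> real" where
  "gromov_product p x y = (dist p x + dist p y - dist x y) / 2"

text \<open>The metric space \<open>X\<close> is the whole type \<open>'a\<close>; \<open>TYPE('a)\<close> names it in predicates
  that have no other argument of this type.\<close>

definition gromov_hyperbolic :: "'a::metric_space itself \<Rightarrow> real \<Rightarrow> bool" where
  "gromov_hyperbolic _ \<delta> \<longleftrightarrow>
     (\<forall>p x y z :: 'a. gromov_product p x z \<ge>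
        min (gromov_product p x y) (gromov_product p y z) - \<delta>)"

definition minimal_geodesic :: "(real \<Rightarrow> 'a::metric_space) \<Rightarrow> 'a \<Rightarrow> 'a \<Rightarrow> bool" where
  "minimal_geodesic \<gamma> x y \<longleftrightarrow> \<gamma> 0 = x \<and> \<gamma> 1 = y \<and>
     (\<forall>s\<in>{0..1}. \<forall>t\<in>{0..1}. dist (\<gamma> s) (\<gamma> t) = \<bar>s - t\<bar> * dist x y)"

definition geodesic_space :: "'a::metric_space itself \<Rightarrow> bool" where
  "geodesic_space _ \<longleftrightarrow> (\<forall>x y :: 'a. \<exists>\<gamma>. minimal_geodesic \<gamma> x y)"

text \<open>On a nonseparable metric space a Borel probability measure need not provably be concentrated on
  its support (this fails if there is a suitable real-valued measurable cardinal), so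
  concentration has to be assumed separately. For separable spaces it is automatic.\<close>

definition measure_support :: "'a::metric_space measure \<Rightarrow> 'a set" where
  "measure_support \<mu> = {x. \<forall>U. open U \<longrightarrow> x \<in> U \<longrightarrow> emeasure \<mu> U > 0}"

text \<open>The set of barycenters, with the reference point \<open>x\<^sub>0\<close> as an explicit argument. It is meant
  for \<open>\<mu>\<close> of finite first moment: then the integrals exist and are bounded below in \<open>y\<close>
  (by minus the square of the first moment about \<open>x\<^sub>0\<close>), so that the real infimum is the
  genuine one, and the set does not depend on \<open>x\<^sub>0\<close>.\<close>

definition barycenters :: "'a::metric_space \<Rightarrow> 'a measure \<Rightarrow> 'a set" where
  "barycenters x\<^sub>0 \<mu> =
     {x. (\<integral>z. ((dist x z)\<^sup>2 - (dist x\<^sub>0 z)\<^sup>2) \<partial>\<mu>)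
           \<le> (INF y. (\<integral>z. ((dist y z)\<^sup>2 - (dist x\<^sub>0 z)\<^sup>2) \<partial>\<mu>))}"

definition proximal :: "('a::metric_space \<Rightarrow> real) \<Rightarrow> real \<Rightarrow> 'a \<Rightarrow> 'a set" where
  "proximal g \<tau> x =
     {y. is_arg_min (\<lambda>y. g y + (dist x y)\<^sup>2 / (2 * \<tau>)) (\<lambda>_. True) y}"

text \<open>The \<open>\<sigma>\<close>-algebra on the sample space generated by \<open>Z\<^sub>1, \<dots>, Z\<^sub>k\<close>
  (trivial for \<open>k = 0\<close>).\<close>

definition past_algebra :: "'w measure \<Rightarrow> (nat \<Rightarrow> 'w \<Rightarrow> 'a::metric_space) \<Rightarrow> nat \<Rightarrow> 'w measure" where
  "past_algebra M Z k =
     vimage_algebra (space M) (\<lambda>\<omega>. \<lambda>i\<in>{1..k}. Z i \<omega>) (Pi\<^sub>M {1..k} (\<lambda>_. borel))"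

text \<open>For \<open>\<delta> = 0\<close> the quotient \<open>2D/\<delta>\<close> is read as infinity, so the minimum is \<open>1/\<tau>\<close>;
  HOL's \<open>2 * D / 0 = 0\<close> would give \<open>0\<close>.\<close>

definition Theta :: "real \<Rightarrow> real \<Rightarrow> real \<Rightarrow> real" where
  "Theta \<delta> \<tau> D =
     max (8 * D + 8 * \<delta>)
         ((4 + 8 * \<tau>) * D * (if \<delta> = 0 then 1 / \<tau> else min (1 / \<tau>) (2 * D / \<delta>)))"

end

theory Submission
  imports Defs
begin

text \<open>
  In a tree, a proximal step moves \<open>S\<^sub>k\<close> along the geodesic to \<open>Z\<^sub>k\<^sub>+\<^sub>1\<close> by the
  fraction \<open>t = 2\<tau> / (1 + 2\<tau>)\<close>, and the CAT(0) inequality combined with the variance inequality of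
  the barycenter \<open>p\<close> gives a contraction of \<open>E d\<^sup>2(p, S\<^sub>k)\<close> towards a level of order
  \<open>D\<^sup>2 \<tau>\<close>. Hyperbolicity perturbs both by terms of order \<open>\<delta> (D + \<delta>)\<close>. The four-point condition gives
  the CAT(0) inequality up to the error \<open>4 D \<delta>\<close> (\<open>hyperbolic_quasi_CAT0\<close>). Applied at the
  midpoint of a geodesic from \<open>p\<close> to \<open>x\<close>, where a barycenter cannot be beaten, it yields
  \<open>\<integral> d\<^sup>2(x, z) - d\<^sup>2(p, z) \<mu>(dz) \<ge> d\<^sup>2(p, x) / 2 - 8 \<delta> (D + \<delta>)\<close>
  (\<open>hyperbolic_variance_inequality\<close>). Since \<open>Z\<^sub>k\<^sub>+\<^sub>1\<close> is independent of \<open>S\<^sub>k\<close>, integration leads to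
  \<open>a\<^sub>k\<^sub>+\<^sub>1 \<le> (1 - 3t/2) a\<^sub>k + 8 t \<delta> (D + \<delta>) + t\<^sup>2 D\<^sup>2 + 4 D \<delta>\<close> for
  \<open>a\<^sub>k = E d\<^sup>2(p, S\<^sub>k)\<close> (\<open>expectation_proximal_step_le\<close>).

  Let \<open>C\<close> be the asserted bound without \<open>\<epsilon>\<close>. If \<open>C \<ge> D\<^sup>2\<close>, then \<open>k\<^sub>0 = 0\<close> works, because
  \<open>a\<^sub>0 \<le> D\<^sup>2\<close>. Otherwise \<open>\<tau> < 1/8\<close>, and the one-step bound is at most
  \<open>a\<^sub>k - \<tau> (a\<^sub>k - C)\<close> (\<open>step_error_absorbed\<close>). As long as \<open>a\<^sub>k > C + \<epsilon>\<close>, each step therefore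
  lowers \<open>a\<^sub>k\<close> by more than \<open>\<tau> \<epsilon>\<close>, which can happen fewer than \<open>a\<^sub>0 / (\<tau> \<epsilon>)\<close> times in a row.

  One measure-theoretic point needs care: on a nonseparable space the distance is
  Borel on the product space, but in general not measurable for the product of the Borel
  \<open>\<sigma>\<close>-algebras, so Fubini's theorem does not apply to it directly. The support of a finite measure is
  separable, however (\<open>separable_measure_support\<close>), and \<open>d(x, z)\<close> agrees with a
  product-measurable function whenever \<open>z\<close> lies in a separable set
  (\<open>measurable_dist_closure_countable\<close>).
\<close>

section \<open>Geometry of the proximal step\<close>

text \<open>Written without Gromov products, the definition says that of the three sums of opposite
  distances in a quadruple, the largest exceeds the second largest by at most \<open>2 \<delta>\<close>.\<close>

lemma gromov_hyperbolic_four_point: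
  fixes p x y z :: "'a::metric_space"
  assumes "gromov_hyperbolic TYPE('a) \<delta>"
  shows "dist p y + dist x z \<le> max (dist p x + dist y z) (dist p z + dist x y) + 2 * \<delta>"
proof -
  have "gromov_product p x z \<ge> min (gromov_product p x y) (gromov_product p y z) - \<delta>"
    using assms unfolding gromov_hyperbolic_def by blast
  then show ?thesis
    unfolding gromov_product_def by (auto simp: min_def max_def field_simps split: if_splits)
qed

text \<open>The maximum is the distance from \<open>q\<close> to the point corresponding to \<open>y\<close> in the comparison
  tripod of \<open>q\<close>, \<open>x\<close>, \<open>z\<close>.\<close>

lemma hyperbolic_dist_to_geodesic_le:
  fixes q x y z :: "'a::metric_space"
  assumes hyp: "gromov_hyperbolic TYPE('a) \<delta>"
    and y: "dist x y = t * dist x z" "dist y z = (1 - t) * dist x z"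
  shows "dist q y \<le> max (dist q x - t * dist x z) (dist q z - (1 - t) * dist x z) + 2 * \<delta>"
  using gromov_hyperbolic_four_point[OF hyp, of q y x z] y
  by (auto simp: max_def algebra_simps split: if_splits)

text \<open>A tripod is CAT(0), so the squared maximum \<open>m\<^sup>2\<close> of the previous lemma satisfies the exact
  inequality. Squaring the additive error \<open>2 \<delta>\<close> costs \<open>2 \<delta> (d(q, y) + m)\<close>, hence the two bounds
  \<open>D\<close> on \<open>m\<close> and \<open>R\<close> on \<open>d(q, y)\<close>: the latter is \<open>D\<close> for the proximal step, which stays in
  \<open>\<Omega>\<close>, but only \<open>D + 2 \<delta>\<close> for a midpoint, which may leave it.\<close>

lemma hyperbolic_quasi_CAT0:
  fixes q x y z :: "'a::metric_space"
  assumes hyp: "gromov_hyperbolic TYPE('a) \<delta>" and "\<delta> \<ge> 0"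
    and t: "0 \<le> t" "t \<le> 1"
    and y: "dist x y = t * dist x z" "dist y z = (1 - t) * dist x z"
    and D: "dist q x \<le> D" "dist q z \<le> D" and R: "dist q y \<le> R"
  shows "(dist q y)\<^sup>2 \<le> (1 - t) * (dist q x)\<^sup>2 + t * (dist q z)\<^sup>2
           - t * (1 - t) * (dist x z)\<^sup>2 + 2 * (D + R) * \<delta>"
proof -
  define a b L where "a = dist q x" and "b = dist q z" and "L = dist x z"
  define m where "m = max (a - t * L) (b - (1 - t) * L)"
  define E where "E = (1 - t) * a\<^sup>2 + t * b\<^sup>2 - t * (1 - t) * L\<^sup>2"
  have tri: "a \<le> b + L" "b \<le> a + L" "L \<le> a + b"
    unfolding a_def b_def L_def by metric+
  have nn: "a \<ge> 0" "b \<ge> 0" "L \<ge> 0" by (auto simp: a_def b_def L_def)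
  have "(a - L)\<^sup>2 \<le> b\<^sup>2" "(b - L)\<^sup>2 \<le> a\<^sup>2"
    using tri by (auto simp: abs_le_square_iff[symmetric])
  then have *: "0 \<le> t * (b\<^sup>2 - (a - L)\<^sup>2)" "0 \<le> (1 - t) * (a\<^sup>2 - (b - L)\<^sup>2)"
    using t by auto
  \<comment> \<open>The two nonnegative terms are the CAT(0) defects on the two branches of the tripod.\<close>
  have "E = (a - t * L)\<^sup>2 + t * (b\<^sup>2 - (a - L)\<^sup>2)"
    "E = (b - (1 - t) * L)\<^sup>2 + (1 - t) * (a\<^sup>2 - (b - L)\<^sup>2)"
    unfolding E_def by (simp_all add: power2_eq_square algebra_simps)
  with * have mE: "m\<^sup>2 \<le> E"
    unfolding m_def by (auto simp: max_def)
  have mD: "m \<le> D"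
  proof -
    have "0 \<le> t * L" "0 \<le> (1 - t) * L" using t nn by auto
    then show ?thesis using D unfolding m_def a_def b_def by linarith
  qed
  have ym: "dist q y \<le> m + 2 * \<delta>"
    using hyperbolic_dist_to_geodesic_le[OF hyp y, of q] unfolding m_def a_def b_def L_def .
  have D0: "D \<ge> 0" using D(1) zero_le_dist[of q x] by linarith
  have R0: "R \<ge> 0" using R zero_le_dist[of q y] by linarith
  have "(dist q y)\<^sup>2 - m\<^sup>2 \<le> 2 * (D + R) * \<delta>"
  proof (cases "dist q y \<le> \<bar>m\<bar>")
    case True
    then have "(dist q y)\<^sup>2 \<le> m\<^sup>2" by (simp add: abs_le_square_iff[symmetric])
    moreover have "0 \<le> 2 * (D + R) * \<delta>" using D0 R0 assms(2) by simp
    ultimately show ?thesis by linarith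
  next
    case False
    have "(dist q y)\<^sup>2 - m\<^sup>2 = (dist q y - m) * (dist q y + m)"
      by (simp add: power2_eq_square algebra_simps)
    also have "\<dots> \<le> (2 * \<delta>) * (R + D)"
      using False ym mD R assms(2) by (intro mult_mono) auto
    finally show ?thesis by (simp add: algebra_simps)
  qed
  with mE show ?thesis unfolding E_def a_def b_def L_def by linarith
qed

text \<open>With \<open>u = d(y, z)\<close>, \<open>v = d(x, y)\<close> and \<open>u + v \<ge> L = d(x, z)\<close>, the Cauchy-Schwarz inequality
  bounds the objective \<open>u\<^sup>2 + v\<^sup>2 / (2\<tau>)\<close> below by \<open>L\<^sup>2 / (1 + 2\<tau>)\<close>. A point on a geodesic attains this
  value, so a minimizer satisfies \<open>v = 2\<tau> u\<close> and \<open>u + v = L\<close>. These two distances are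
  all that the four-point condition uses of the geodesic through \<open>y\<close>.\<close>

lemma proximal_sq_dist_divides:
  fixes x y z :: "'a::metric_space"
  assumes geo: "geodesic_space TYPE('a)" and \<tau>: "\<tau> > 0"
    and y: "y \<in> proximal (\<lambda>y. (dist z y)\<^sup>2) \<tau> x"
  defines "t \<equiv> 2 * \<tau> / (1 + 2 * \<tau>)"
  shows "dist x y = t * dist x z" "dist y z = (1 - t) * dist x z"
proof -
  define L u v where "L = dist x z" and "u = dist y z" and "v = dist x y"
  have tri: "L \<le> u + v" unfolding L_def u_def v_def by metric
  have nn: "L \<ge> 0" "u \<ge> 0" "v \<ge> 0" by (auto simp: L_def u_def v_def)
  have t: "0 \<le> t" "t \<le> 1" "1 - t = 1 / (1 + 2 * \<tau>)"
    using \<tau> by (auto simp: t_def field_simps)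
  obtain \<gamma> where \<gamma>: "minimal_geodesic \<gamma> x z"
    using geo unfolding geodesic_space_def by blast
  have \<gamma>01: "\<gamma> 0 = x" "\<gamma> 1 = z"
    and \<gamma>d: "\<And>r s. r \<in> {0..1} \<Longrightarrow> s \<in> {0..1} \<Longrightarrow> dist (\<gamma> r) (\<gamma> s) = \<bar>r - s\<bar> * L"
    using \<gamma> unfolding minimal_geodesic_def L_def by blast+
  have g: "dist x (\<gamma> t) = t * L" "dist z (\<gamma> t) = (1 - t) * L"
    using \<gamma>d[of 0 t] \<gamma>d[of 1 t] \<gamma>01 t(1,2) by auto
  have "u\<^sup>2 + v\<^sup>2 / (2 * \<tau>) \<le> (dist z (\<gamma> t))\<^sup>2 + (dist x (\<gamma> t))\<^sup>2 / (2 * \<tau>)"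
    using y unfolding proximal_def is_arg_min_linorder u_def v_def
    by (auto simp: dist_commute)
  also have "\<dots> = L\<^sup>2 / (1 + 2 * \<tau>)"
    unfolding g t(3) using \<tau> unfolding t_def
    by (simp add: divide_simps) (simp add: power2_eq_square algebra_simps)
  finally have le: "u\<^sup>2 + v\<^sup>2 / (2 * \<tau>) \<le> L\<^sup>2 / (1 + 2 * \<tau>)" .
  have "L\<^sup>2 \<le> (u + v)\<^sup>2" using tri nn by (intro power_mono) auto
  then have "L\<^sup>2 / (1 + 2 * \<tau>) \<le> (u + v)\<^sup>2 / (1 + 2 * \<tau>)"
    using \<tau> by (intro divide_right_mono) auto
  \<comment> \<open>the defect in the Cauchy-Schwarz inequality\<close>
  moreover have "u\<^sup>2 + v\<^sup>2 / (2 * \<tau>) = (u + v)\<^sup>2 / (1 + 2 * \<tau>) + (2 * \<tau> * u - v)\<^sup>2 / (2 * \<tau> * (1 + 2 * \<tau>))"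
    using \<tau> by (simp add: divide_simps) (simp add: power2_eq_square algebra_simps)
  moreover have "(2 * \<tau> * u - v)\<^sup>2 / (2 * \<tau> * (1 + 2 * \<tau>)) \<ge> 0" using \<tau> by auto
  ultimately have "(2 * \<tau> * u - v)\<^sup>2 / (2 * \<tau> * (1 + 2 * \<tau>)) = 0"
    and "(u + v)\<^sup>2 / (1 + 2 * \<tau>) = L\<^sup>2 / (1 + 2 * \<tau>)"
    using le by linarith+
  then have "2 * \<tau> * u - v = 0" "(u + v)\<^sup>2 = L\<^sup>2" using \<tau> by auto
  then have v: "v = 2 * \<tau> * u" and "u + v = L" using nn by (auto simp: power2_eq_iff)
  then have u: "L = (1 + 2 * \<tau>) * u" by (simp add: algebra_simps)
  show "dist x y = t * dist x z" "dist y z = (1 - t) * dist x z"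
    unfolding L_def[symmetric] u_def[symmetric] v_def[symmetric] t(3)
    using u v \<tau> by (auto simp: t_def)
qed

section \<open>Barycenters\<close>

text \<open>With one argument constant, continuity of \<open>dist\<close> suffices, and second countability is not an
  issue.\<close>

lemma borel_measurable_dist_const [measurable (raw)]:
  fixes y :: "'b::metric_space"
  assumes "f \<in> borel_measurable M"
  shows "(\<lambda>x. dist y (f x)) \<in> borel_measurable M" "(\<lambda>x. dist (f x) y) \<in> borel_measurable M"
  by (rule measurable_compose[OF assms borel_measurable_continuous_onI], intro continuous_intros)+

lemma (in finite_measure) integrable_dist_power2:
  fixes p y :: "'b::metric_space"
  assumes f [measurable]: "f \<in> borel_measurable M" and b: "AE x in M. dist p (f x) \<le> D"
  shows "integrable M (\<lambda>x. (dist y (f x))\<^sup>2)"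
proof (rule integrable_const_bound)
  show "AE x in M. norm ((dist y (f x))\<^sup>2) \<le> (dist y p + D)\<^sup>2"
    using b
  proof eventually_elim
    case (elim x)
    have "dist y (f x) \<le> dist y p + D" using elim dist_triangle[of y "f x" p] by linarith
    then show ?case by (auto intro!: power_mono)
  qed
qed measurable

text \<open>On bounded sets the reference point cancels. The real infimum in the definition is the genuine
  one because \<open>d\<^sup>2(y, z) \<ge> 0\<close> makes the family bounded below.\<close>

lemma barycenters_minimizes:
  fixes \<mu> :: "'a::metric_space measure"
  assumes "prob_space \<mu>" and sets [measurable_cong]: "sets \<mu> = sets borel"
    and p: "p \<in> barycenters x\<^sub>0 \<mu>" and D: "AE z in \<mu>. dist p z \<le> D"
  shows "(\<integral>z. (dist p z)\<^sup>2 \<partial>\<mu>) \<le> (\<integral>z. (dist y z)\<^sup>2 \<partial>\<mu>)"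
proof -
  interpret prob_space \<mu> by fact
  define F where "F y = (\<integral>z. ((dist y z)\<^sup>2 - (dist x\<^sub>0 z)\<^sup>2) \<partial>\<mu>)" for y
  have int: "integrable \<mu> (\<lambda>z. (dist y z)\<^sup>2)" for y
    by (rule integrable_dist_power2[OF _ D]) measurable
  have F: "F y = (\<integral>z. (dist y z)\<^sup>2 \<partial>\<mu>) - (\<integral>z. (dist x\<^sub>0 z)\<^sup>2 \<partial>\<mu>)" for y
    unfolding F_def by (simp add: int)
  have "bdd_below (range F)"
    by (rule bdd_belowI[of _ "- (\<integral>z. (dist x\<^sub>0 z)\<^sup>2 \<partial>\<mu>)"]) (auto simp: F)
  then have "(INF y. F y) \<le> F y" by (intro cINF_lower) auto
  moreover have "F p \<le> (INF y. F y)" using p unfolding barycenters_def F_def by simp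
  ultimately show ?thesis unfolding F by linarith
qed

text \<open>Comparing \<open>p\<close> with the point at fraction \<open>s\<close> of a geodesic from \<open>p\<close> to \<open>x\<close> gives the factor
  \<open>1 - s\<close> in front of \<open>d\<^sup>2(p, x)\<close> at the price of the error \<open>4 \<delta> (D + \<delta>) / s\<close>. Unlike in CAT(0)
  spaces, \<open>s\<close> therefore cannot tend to \<open>0\<close>; \<open>s = 1/2\<close> keeps both constants moderate.\<close>

lemma hyperbolic_variance_inequality:
  fixes \<mu> :: "'a::metric_space measure"
  assumes \<delta>: "\<delta> \<ge> 0" and geo: "geodesic_space TYPE('a)" and hyp: "gromov_hyperbolic TYPE('a) \<delta>"
    and "prob_space \<mu>" and sets [measurable_cong]: "sets \<mu> = sets borel"
    and p: "p \<in> barycenters x\<^sub>0 \<mu>"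
    and D: "AE z in \<mu>. dist p z \<le> D" "AE z in \<mu>. dist x z \<le> D"
  shows "(\<integral>z. (dist p z)\<^sup>2 \<partial>\<mu>) + (dist p x)\<^sup>2 / 2 - 8 * \<delta> * (D + \<delta>) \<le> (\<integral>z. (dist x z)\<^sup>2 \<partial>\<mu>)"
proof -
  interpret prob_space \<mu> by fact
  have int [simp]: "integrable \<mu> (\<lambda>z. (dist y z)\<^sup>2)" for y
    by (rule integrable_dist_power2[OF _ D(1)]) measurable
  obtain \<gamma> where "minimal_geodesic \<gamma> p x"
    using geo unfolding geodesic_space_def by blast
  then have \<gamma>: "\<gamma> 0 = p" "\<gamma> 1 = x"
    "\<And>r s. r \<in> {0..1} \<Longrightarrow> s \<in> {0..1} \<Longrightarrow> dist (\<gamma> r) (\<gamma> s) = \<bar>r - s\<bar> * dist p x"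
    unfolding minimal_geodesic_def by blast+
  define m where "m = \<gamma> (1/2)"
  have m: "dist p m = 1/2 * dist p x" "dist m x = (1 - 1/2) * dist p x"
    using \<gamma>(3)[of 0 "1/2"] \<gamma>(3)[of "1/2" 1] \<gamma>(1,2) by (auto simp: m_def)
  have "AE z in \<mu>. (dist m z)\<^sup>2 \<le> (dist p z)\<^sup>2 / 2 + (dist x z)\<^sup>2 / 2
            - (dist p x)\<^sup>2 / 4 + 4 * \<delta> * (D + \<delta>)"
    using D
  proof eventually_elim
    case (elim z)
    have "dist z m \<le> D + 2 * \<delta>"
    proof -
      have "dist z p \<le> D" "dist z x \<le> D" "0 \<le> dist p x" using elim by (simp_all add: dist_commute)
      then have "max (dist z p - dist p x / 2) (dist z x - dist p x / 2) \<le> D"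
        by (intro max.boundedI) linarith+
      then show ?thesis using hyperbolic_dist_to_geodesic_le[OF hyp m, of z] by simp linarith
    qed
    from hyperbolic_quasi_CAT0[OF hyp \<delta> _ _ m _ _ this, of D] elim
    show ?case by (simp add: dist_commute algebra_simps)
  qed
  then have "(\<integral>z. (dist m z)\<^sup>2 \<partial>\<mu>) \<le> (\<integral>z. ((dist p z)\<^sup>2 / 2 + (dist x z)\<^sup>2 / 2
            - (dist p x)\<^sup>2 / 4 + 4 * \<delta> * (D + \<delta>)) \<partial>\<mu>)"
    by (intro integral_mono_AE) auto
  also have "\<dots> = (\<integral>z. (dist p z)\<^sup>2 \<partial>\<mu>) / 2 + (\<integral>z. (dist x z)\<^sup>2 \<partial>\<mu>) / 2
            - (dist p x)\<^sup>2 / 4 + 4 * \<delta> * (D + \<delta>)"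
    by (simp add: prob_space)
  finally show ?thesis
    using barycenters_minimizes[OF \<open>prob_space \<mu>\<close> sets p D(1), of m] by linarith
qed

section \<open>Separability of the support\<close>

text \<open>The balls are disjoint, so each of them uses up at least \<open>c\<close> of the finite total mass.\<close>

lemma finite_measure_separated_card_le:
  fixes \<mu> :: "'a::metric_space measure"
  assumes "finite_measure \<mu>" and sets: "sets \<mu> = sets borel" and e: "e > 0" and c: "c > 0"
    and A: "A \<subseteq> {x. measure \<mu> (ball x e) \<ge> c}"
    and fin: "finite A" and sep: "\<And>x y. x \<in> A \<Longrightarrow> y \<in> A \<Longrightarrow> x \<noteq> y \<Longrightarrow> dist x y \<ge> 2 * e"
  shows "card A \<le> nat \<lfloor>measure \<mu> (space \<mu>) / c\<rfloor>"
proof -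
  interpret finite_measure \<mu> by fact
  have "disjoint_family_on (\<lambda>x. ball x e) A"
    unfolding disjoint_family_on_def
  proof (intro ballI impI)
    fix x y assume "x \<in> A" "y \<in> A" "x \<noteq> y"
    then have "2 * e \<le> dist x y" by (rule sep)
    then show "ball x e \<inter> ball y e = {}" by (intro disjoint_ballI) auto
  qed
  then have "(\<Sum>x\<in>A. measure \<mu> (ball x e)) = measure \<mu> (\<Union>x\<in>A. ball x e)"
    by (intro finite_measure_finite_Union[symmetric] fin) (auto simp: sets)
  also have "\<dots> \<le> measure \<mu> (space \<mu>)" by (rule bounded_measure)
  finally have "(\<Sum>x\<in>A. measure \<mu> (ball x e)) \<le> measure \<mu> (space \<mu>)" .
  moreover have "(\<Sum>x\<in>A. c) \<le> (\<Sum>x\<in>A. measure \<mu> (ball x e))"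
    using A by (intro sum_mono) auto
  ultimately have "real (card A) * c \<le> measure \<mu> (space \<mu>)" by simp
  then show ?thesis using c by (simp add: le_nat_floor field_simps)
qed

text \<open>By the previous lemma, a separated set of largest cardinality exists among the points whose
  \<open>e\<close>-ball has mass at least \<open>c\<close>, and by maximality it is a finite net for these points. Every
  point of the support has such balls for all \<open>e\<close> and some \<open>c\<close> depending on \<open>e\<close>, so the nets for
  countably many \<open>e\<close> and \<open>c\<close> accumulate at it.\<close>

lemma separable_measure_support:
  fixes \<mu> :: "'a::metric_space measure"
  assumes "finite_measure \<mu>" and sets: "sets \<mu> = sets borel"
  shows "\<exists>C. countable C \<and> measure_support \<mu> \<subseteq> closure C"
proof -
  interpret finite_measure \<mu> by fact
  have "\<exists>B. finite B \<and> (\<forall>x. measure \<mu> (ball x e) \<ge> c \<longrightarrow> (\<exists>q\<in>B. dist x q < 2 * e))"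
    if e: "e > 0" and c: "c > 0" for e c :: real
  proof -
    define P where "P A \<longleftrightarrow> finite A \<and> A \<subseteq> {x. measure \<mu> (ball x e) \<ge> c} \<and>
      (\<forall>x\<in>A. \<forall>y\<in>A. x \<noteq> y \<longrightarrow> dist x y \<ge> 2 * e)" for A
    have "card A < Suc (nat \<lfloor>measure \<mu> (space \<mu>) / c\<rfloor>)" if "P A" for A
      using finite_measure_separated_card_le[OF assms e c, of A] that
      unfolding P_def by (simp add: less_Suc_eq_le)
    moreover have "P {}" unfolding P_def by simp
    ultimately obtain B where B: "P B" and max: "\<And>A. P A \<Longrightarrow> card A \<le> card B"
      using Lattices_Big.ex_has_greatest_nat[of P "{}" card] by blast
    have "\<exists>q\<in>B. dist x q < 2 * e" if x: "measure \<mu> (ball x e) \<ge> c" for x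
    proof (rule ccontr)
      assume *: "\<not> ?thesis"
      then have "x \<notin> B" using e by (metis dist_self mult_pos_pos zero_less_numeral)
      moreover have "P (insert x B)"
        using B x * unfolding P_def by (auto simp: not_less dist_commute)
      ultimately show False using max[of "insert x B"] B unfolding P_def by simp
    qed
    moreover have "finite B" using B unfolding P_def by simp
    ultimately show ?thesis by blast
  qed
  then have "\<forall>e c. \<exists>B. e > 0 \<longrightarrow> c > 0 \<longrightarrow>
      finite B \<and> (\<forall>x. measure \<mu> (ball x e) \<ge> c \<longrightarrow> (\<exists>q\<in>B. dist x q < 2 * e))"
    by blast
  from this[unfolded choice_iff] obtain B where B: "\<And>e c. e > 0 \<Longrightarrow> c > 0 \<Longrightarrow> finite (B e c)"
    "\<And>e c x. e > 0 \<Longrightarrow> c > 0 \<Longrightarrow> measure \<mu> (ball x e) \<ge> c \<Longrightarrow> \<exists>q\<in>B e c. dist x q < 2 * e"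
    by blast
  define r where "r n = inverse (real (Suc n))" for n
  define C where "C = (\<Union>m n. B (r m) (r n))"
  have r: "r n > 0" for n by (simp add: r_def)
  have "countable C"
    unfolding C_def by (simp add: B(1) r countable_finite)
  moreover have "x \<in> closure C" if x: "x \<in> measure_support \<mu>" for x
    unfolding closure_approachable
  proof (intro allI impI)
    fix e :: real assume "0 < e"
    then obtain m where m: "r m < e / 2"
      using reals_Archimedean[of "e / 2"] unfolding r_def by auto
    have "emeasure \<mu> (ball x (r m)) > 0"
      using x r unfolding measure_support_def by auto
    then have "measure \<mu> (ball x (r m)) > 0" by (simp add: emeasure_eq_measure)
    then obtain n where "r n < measure \<mu> (ball x (r m))"
      using reals_Archimedean unfolding r_def by blast
    then obtain q where "q \<in> B (r m) (r n)" "dist x q < 2 * r m"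
      using B(2)[of "r m" "r n" x] r by auto
    then have "q \<in> C" "dist q x < e" using m by (auto simp: C_def dist_commute)
    then show "\<exists>q\<in>C. dist q x < e" by blast
  qed
  ultimately show ?thesis by blast
qed

text \<open>The triangle inequality \<open>d(x, z) \<le> d(x, q) + d(q, z)\<close> is an equality in the limit
  \<open>q \<rightarrow> z\<close>. So \<open>d(x, z)\<close> is a countable infimum of sums of functions of one variable each.\<close>

lemma measurable_dist_closure_countable:
  fixes C :: "'a::metric_space set"
  assumes "countable C"
  shows "\<exists>h \<in> borel_measurable (borel \<Otimes>\<^sub>M borel). \<forall>x. \<forall>z\<in>closure C. h (x, z) = dist x z"
proof
  define h :: "'a \<times> 'a \<Rightarrow> real" where "h w = (INF q\<in>C. dist (fst w) q + dist (snd w) q)" for w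
  show "h \<in> borel_measurable (borel \<Otimes>\<^sub>M borel)"
    unfolding h_def using assms by (intro borel_measurable_cINF_real) measurable
  have "h (x, z) = dist x z" if z: "z \<in> closure C" for x z
  proof (rule antisym)
    have ne: "C \<noteq> {}" using z by auto
    show "dist x z \<le> h (x, z)"
      unfolding h_def by (intro cINF_greatest ne) (auto intro: dist_triangle2)
    show "h (x, z) \<le> dist x z"
    proof (rule field_le_epsilon)
      fix e :: real assume "0 < e"
      then obtain q where q: "q \<in> C" "dist q z < e / 2"
        using z unfolding closure_approachable by (metis half_gt_zero)
      have "h (x, z) \<le> dist x q + dist z q"
        unfolding h_def by (rule cINF_lower2[OF _ q(1)]) (auto intro: bdd_belowI[of _ 0])
      also have "\<dots> \<le> dist x z + e"
        using q(2) dist_triangle[of x q z] by (simp add: dist_commute)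
      finally show "h (x, z) \<le> dist x z + e" .
    qed
  qed
  then show "\<forall>x. \<forall>z\<in>closure C. h (x, z) = dist x z" by blast
qed

section \<open>Independence of the past\<close>

text \<open>Fubini's theorem for the joint distribution, which is a product by independence.\<close>

lemma (in prob_space) indep_var_integral_fst:
  fixes h :: "'b \<times> 'b \<Rightarrow> real"
  assumes ind: "indep_var S X T Y" and h [measurable]: "h \<in> borel_measurable (S \<Otimes>\<^sub>M T)"
    and int: "integrable M (\<lambda>\<omega>. h (X \<omega>, Y \<omega>))"
  shows "integrable M (\<lambda>\<omega>. \<integral>z. h (X \<omega>, z) \<partial>distr M T Y)"
    and "expectation (\<lambda>\<omega>. h (X \<omega>, Y \<omega>)) = expectation (\<lambda>\<omega>. \<integral>z. h (X \<omega>, z) \<partial>distr M T Y)"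
proof -
  have [measurable]: "random_variable S X" "random_variable T Y"
    and eq: "distr M (S \<Otimes>\<^sub>M T) (\<lambda>x. (X x, Y x)) = distr M S X \<Otimes>\<^sub>M distr M T Y"
    using ind by (auto simp: indep_var_distribution_eq)
  interpret X: prob_space "distr M S X" by (rule prob_space_distr) measurable
  interpret Y: prob_space "distr M T Y" by (rule prob_space_distr) measurable
  interpret P: pair_sigma_finite "distr M S X" "distr M T Y" ..
  have hint: "integrable (distr M S X \<Otimes>\<^sub>M distr M T Y) h"
    unfolding eq[symmetric] by (subst integrable_distr_eq) (use int in auto)
  have "integrable (distr M S X) (\<lambda>x. \<integral>z. h (x, z) \<partial>distr M T Y)"
    by (rule P.integrable_fst'[OF hint])
  then show "integrable M (\<lambda>\<omega>. \<integral>z. h (X \<omega>, z) \<partial>distr M T Y)"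
    by (subst (asm) integrable_distr_eq) measurable
  have "expectation (\<lambda>\<omega>. h (X \<omega>, Y \<omega>)) = integral\<^sup>L (distr M S X \<Otimes>\<^sub>M distr M T Y) h"
    unfolding eq[symmetric] by (subst integral_distr) auto
  also have "\<dots> = (\<integral>x. (\<integral>z. h (x, z) \<partial>distr M T Y) \<partial>distr M S X)"
    by (rule P.integral_fst'[OF hint, symmetric])
  also have "\<dots> = expectation (\<lambda>\<omega>. \<integral>z. h (X \<omega>, z) \<partial>distr M T Y)"
    by (rule integral_distr) measurable
  finally show "expectation (\<lambda>\<omega>. h (X \<omega>, Y \<omega>)) = expectation (\<lambda>\<omega>. \<integral>z. h (X \<omega>, z) \<partial>distr M T Y)" .
qed

text \<open>The argument compares generated \<open>\<sigma>\<close>-algebras rather than writing \<open>X\<close> as a function of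
  \<open>Z\<^sub>1, \<dots>, Z\<^sub>k\<close>: such a factorization is available for values in a standard Borel space, but not in
  an arbitrary metric space.\<close>

lemma (in prob_space) indep_var_past_algebra:
  fixes Z :: "nat \<Rightarrow> 'a \<Rightarrow> 'b::metric_space" and X :: "'a \<Rightarrow> 'b"
  assumes ind: "indep_vars (\<lambda>_. borel) Z {1..}"
    and X: "X \<in> borel_measurable (past_algebra M Z k)"
  shows "indep_var borel X borel (Z (Suc k))"
proof -
  let ?P = "\<lambda>I. Pi\<^sub>M I (\<lambda>_. borel :: 'b measure)" and ?R = "\<lambda>I \<omega>. \<lambda>i\<in>I. Z i \<omega>"
  define N where "N = vimage_algebra (space M) (?R {Suc k}) (?P {Suc k})"
  have "indep_var (?P {1..k}) (?R {1..k}) (?P {Suc k}) (?R {Suc k})"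
    by (rule indep_var_restrict[OF ind]) auto
  then have indep: "indep_set (sets (past_algebra M Z k)) (sets N)"
    unfolding indep_var_eq past_algebra_def N_def sets_vimage_algebra by blast
  have sp: "space (past_algebra M Z k) = space M" "space N = space M"
    by (simp_all add: past_algebra_def N_def)
  have "(\<lambda>\<omega>. ?R {Suc k} \<omega> (Suc k)) \<in> borel_measurable N"
    unfolding N_def
    by (rule measurable_compose[OF measurable_vimage_algebra1 measurable_component_singleton])
      (auto simp: space_PiM split: if_splits)
  then have Z: "Z (Suc k) \<in> borel_measurable N" by simp
  have sub: "sets (past_algebra M Z k) \<subseteq> sets M" "sets N \<subseteq> sets M"
    using indep by (auto simp: indep_set_def indep_sets_def split: bool.splits)
  have rv: "random_variable borel X" "random_variable borel (Z (Suc k))"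
    using X Z sp sub unfolding measurable_def by auto
  have X_sub: "sigma_sets (space M) {X -` A \<inter> space M |A. A \<in> sets borel} \<subseteq> sets (past_algebra M Z k)"
    unfolding sp(1)[symmetric] using X by (intro sets.sigma_sets_subset) (auto intro: measurable_sets)
  have Z_sub: "sigma_sets (space M) {Z (Suc k) -` A \<inter> space M |A. A \<in> sets borel} \<subseteq> sets N"
    unfolding sp(2)[symmetric] using Z by (intro sets.sigma_sets_subset) (auto intro: measurable_sets)
  have "indep_set (sigma_sets (space M) {X -` A \<inter> space M |A. A \<in> sets borel})
      (sigma_sets (space M) {Z (Suc k) -` A \<inter> space M |A. A \<in> sets borel})"
    using indep unfolding indep_set_def
    by (rule indep_sets_mono_sets) (use X_sub Z_sub in \<open>auto split: bool.split\<close>)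
  then show ?thesis unfolding indep_var_eq using rv by blast
qed

section \<open>The stochastic proximal point method\<close>

text \<open>Write \<open>A = E d\<^sup>2(p, X)\<close>, \<open>V = E d\<^sup>2(p, Z)\<close> and \<open>B = E d\<^sup>2(X, Z)\<close>. The quasi-CAT(0) inequality
  bounds the left side by \<open>(1 - t) A + t (V - B) + t\<^sup>2 B + 4 D \<delta>\<close>. Here \<open>B \<le> D\<^sup>2\<close>, while
  independence allows the variance inequality to be applied with \<open>X\<close> held fixed, so that
  \<open>V - B \<le> 8 \<delta> (D + \<delta>) - A / 2\<close>.\<close>

lemma (in prob_space) expectation_proximal_step_le:
  fixes X Y Z :: "'a \<Rightarrow> 'b::metric_space"
  assumes \<delta>: "\<delta> \<ge> 0" and geo: "geodesic_space TYPE('b)" and hyp: "gromov_hyperbolic TYPE('b) \<delta>"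
    and ind: "indep_var borel X borel Z" and Y [measurable]: "random_variable borel Y"
    and p: "p \<in> barycenters x\<^sub>0 (distr M borel Z)"
    and supp: "AE z in distr M borel Z. z \<in> measure_support (distr M borel Z)"
    and \<tau>: "\<tau> > 0"
    and prox: "\<And>\<omega>. \<omega> \<in> space M \<Longrightarrow> Y \<omega> \<in> proximal (\<lambda>y. (dist (Z \<omega>) y)\<^sup>2) \<tau> (X \<omega>)"
    and \<Omega>: "bounded \<Omega>" "p \<in> \<Omega>" "measure_support (distr M borel Z) \<subseteq> \<Omega>"
    and X\<Omega>: "AE \<omega> in M. X \<omega> \<in> \<Omega>" and Y\<Omega>: "AE \<omega> in M. Y \<omega> \<in> \<Omega>"
  defines "t \<equiv> 2 * \<tau> / (1 + 2 * \<tau>)" and "D \<equiv> diameter \<Omega>"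
  shows "expectation (\<lambda>\<omega>. (dist p (Y \<omega>))\<^sup>2) \<le>
    (1 - 3 / 2 * t) * expectation (\<lambda>\<omega>. (dist p (X \<omega>))\<^sup>2) + 8 * t * \<delta> * (D + \<delta>) + t\<^sup>2 * D\<^sup>2 + 4 * D * \<delta>"
proof -
  define \<mu> where "\<mu> = distr M borel Z"
  have X [measurable]: "random_variable borel X" and Z [measurable]: "random_variable borel Z"
    using indep_var_rv1[OF ind] indep_var_rv2[OF ind] .
  have sets [measurable_cong]: "sets \<mu> = sets borel" by (simp add: \<mu>_def)
  interpret \<mu>: prob_space \<mu> unfolding \<mu>_def by (rule prob_space_distr) measurable
  have t: "0 \<le> t" "t \<le> 1" using \<tau> by (auto simp: t_def field_simps)
  have D: "dist x y \<le> D" if "x \<in> \<Omega>" "y \<in> \<Omega>" for x y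
    unfolding D_def using diameter_bounded_bound[OF \<Omega>(1) that] .
  obtain C where C: "countable C" "measure_support \<mu> \<subseteq> closure C"
    using separable_measure_support[OF \<mu>.finite_measure_axioms sets] by blast
  \<comment> \<open>a product-measurable stand-in for the distance, exact wherever \<open>Z\<close> takes its values\<close>
  then obtain h where h [measurable]: "h \<in> borel_measurable (borel \<Otimes>\<^sub>M borel)"
    and hd: "\<And>x z. z \<in> measure_support \<mu> \<Longrightarrow> h (x, z) = dist x z"
    using measurable_dist_closure_countable[OF C(1)] by blast
  have supp': "AE z in \<mu>. z \<in> measure_support \<mu>" using supp unfolding \<mu>_def .
  have Zsupp: "AE \<omega> in M. Z \<omega> \<in> measure_support \<mu>"
    using supp unfolding \<mu>_def by (rule AE_distrD[OF Z])
  have Z\<Omega>: "AE \<omega> in M. Z \<omega> \<in> \<Omega>" using Zsupp \<Omega>(3) by (auto simp: \<mu>_def elim!: eventually_mono)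
  have intM: "integrable M (\<lambda>\<omega>. (dist p (W \<omega>))\<^sup>2)"
    if "random_variable borel W" "AE \<omega> in M. W \<omega> \<in> \<Omega>" for W
  proof (rule integrable_dist_power2[OF that(1)])
    show "AE \<omega> in M. dist p (W \<omega>) \<le> D" using that(2) D \<Omega>(2) by (auto elim!: eventually_mono)
  qed
  have inth: "integrable M (\<lambda>\<omega>. (h (X \<omega>, Z \<omega>))\<^sup>2)" and hD: "AE \<omega> in M. (h (X \<omega>, Z \<omega>))\<^sup>2 \<le> D\<^sup>2"
  proof -
    show *: "AE \<omega> in M. (h (X \<omega>, Z \<omega>))\<^sup>2 \<le> D\<^sup>2"
      using X\<Omega> Z\<Omega> Zsupp by eventually_elim (auto simp: hd intro!: power_mono D)
    show "integrable M (\<lambda>\<omega>. (h (X \<omega>, Z \<omega>))\<^sup>2)"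
      by (rule integrable_const_bound[of _ "D\<^sup>2"]) (use * in auto)
  qed
  define A B V where "A = expectation (\<lambda>\<omega>. (dist p (X \<omega>))\<^sup>2)"
    and "B = expectation (\<lambda>\<omega>. (h (X \<omega>, Z \<omega>))\<^sup>2)"
    and "V = (\<integral>z. (dist p z)\<^sup>2 \<partial>\<mu>)"
  have V: "V = expectation (\<lambda>\<omega>. (dist p (Z \<omega>))\<^sup>2)"
    unfolding V_def \<mu>_def by (subst integral_distr) auto
  have BD: "B \<le> D\<^sup>2"
    unfolding B_def by (rule integral_le_const[OF inth hD])
  define G where "G x = (\<integral>z. (h (x, z))\<^sup>2 \<partial>\<mu>)" for x
  have intG: "integrable M (\<lambda>\<omega>. G (X \<omega>))" and BG: "B = expectation (\<lambda>\<omega>. G (X \<omega>))"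
    using indep_var_integral_fst[OF ind, of "\<lambda>w. (h w)\<^sup>2"] inth
    unfolding G_def \<mu>_def B_def by auto
  have "AE \<omega> in M. V + (dist p (X \<omega>))\<^sup>2 / 2 - 8 * \<delta> * (D + \<delta>) \<le> G (X \<omega>)"
    using X\<Omega>
  proof eventually_elim
    case (elim \<omega>)
    have "G (X \<omega>) = (\<integral>z. (dist (X \<omega>) z)\<^sup>2 \<partial>\<mu>)"
      unfolding G_def using supp' by (intro integral_cong_AE) (auto simp: hd elim!: eventually_mono)
    moreover have "AE z in \<mu>. dist y z \<le> D" if "y \<in> \<Omega>" for y
      using supp' \<Omega>(3) that D by (auto simp: \<mu>_def elim!: eventually_mono)
    ultimately show ?case
      using hyperbolic_variance_inequality[OF \<delta> geo hyp \<mu>.prob_space_axioms sets, of p x\<^sub>0 D "X \<omega>"]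
        p \<Omega>(2) elim by (simp add: V_def \<mu>_def)
  qed
  then have "expectation (\<lambda>\<omega>. V + (dist p (X \<omega>))\<^sup>2 / 2 - 8 * \<delta> * (D + \<delta>)) \<le> B"
    unfolding BG using intG intM[OF X X\<Omega>] by (intro integral_mono_AE) auto
  then have BV: "V + A / 2 - 8 * \<delta> * (D + \<delta>) \<le> B"
    using intM[OF X X\<Omega>] by (simp add: A_def prob_space)
  have "AE \<omega> in M. (dist p (Y \<omega>))\<^sup>2 \<le> (1 - t) * (dist p (X \<omega>))\<^sup>2 + t * (dist p (Z \<omega>))\<^sup>2
           - t * (1 - t) * (h (X \<omega>, Z \<omega>))\<^sup>2 + 4 * D * \<delta>"
    using X\<Omega> Y\<Omega> Z\<Omega> Zsupp AE_space
  proof eventually_elim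
    case (elim \<omega>)
    show ?case
      using hyperbolic_quasi_CAT0[OF hyp \<delta> t
          proximal_sq_dist_divides[OF geo \<tau> prox[OF elim(5)], folded t_def], of p D D]
        elim D[OF \<Omega>(2)] by (simp add: hd)
  qed
  then have "expectation (\<lambda>\<omega>. (dist p (Y \<omega>))\<^sup>2) \<le>
     expectation (\<lambda>\<omega>. (1 - t) * (dist p (X \<omega>))\<^sup>2 + t * (dist p (Z \<omega>))\<^sup>2
           - t * (1 - t) * (h (X \<omega>, Z \<omega>))\<^sup>2 + 4 * D * \<delta>)"
    using intM[OF X X\<Omega>] intM[OF Y Y\<Omega>] intM[OF Z Z\<Omega>] inth by (intro integral_mono_AE) auto
  also have "\<dots> = (1 - t) * A + t * V - t * (1 - t) * B + 4 * D * \<delta>"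
    using intM[OF X X\<Omega>] intM[OF Z Z\<Omega>] inth by (simp add: A_def V B_def prob_space)
  also have "\<dots> = (1 - t) * A + t * (V - B) + t\<^sup>2 * B + 4 * D * \<delta>"
    by (simp add: power2_eq_square algebra_simps)
  also have "\<dots> \<le> (1 - t) * A + t * (8 * \<delta> * (D + \<delta>) - A / 2) + t\<^sup>2 * D\<^sup>2 + 4 * D * \<delta>"
    using BV BD t by (intro add_mono mult_left_mono order_refl) auto
  also have "\<dots> = (1 - 3 / 2 * t) * A + 8 * t * \<delta> * (D + \<delta>) + t\<^sup>2 * D\<^sup>2 + 4 * D * \<delta>"
    by (simp add: algebra_simps)
  finally show ?thesis unfolding A_def .
qed

text \<open>The assumption \<open>C < D\<^sup>2\<close> forces \<open>8 \<tau> < 1\<close>, whence \<open>3t/2 \<ge> \<tau>\<close>, and \<open>2 D / \<delta> \<ge> 1 / \<tau>\<close>, since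
  otherwise the minimum in \<open>\<Theta>\<close> alone would make \<open>C \<ge> 8 D\<^sup>2\<close>. So \<open>\<Theta>\<close> is at least
  \<open>4 D / \<tau>\<close>, which is exactly what pays for the error \<open>4 D \<delta>\<close>: unlike the other errors, it does not
  shrink with \<open>\<tau>\<close>. If \<open>\<delta> = 0\<close>, there is nothing to pay.\<close>

lemma step_error_absorbed:
  fixes \<delta> \<tau> D A :: real
  defines "t \<equiv> 2 * \<tau> / (1 + 2 * \<tau>)"
    and "C \<equiv> 8 * D\<^sup>2 * \<tau> + (Theta \<delta> \<tau> D + 16 * D + 16 * \<delta>) * \<delta>"
  assumes "\<delta> \<ge> 0" and "\<tau> > 0" and "D \<ge> 0" and A: "0 \<le> A" and "C < D\<^sup>2"
  shows "(1 - 3 / 2 * t) * A + 8 * t * \<delta> * (D + \<delta>) + t\<^sup>2 * D\<^sup>2 + 4 * D * \<delta> \<le> A - \<tau> * (A - C)"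
proof -
  note small = \<open>C < D\<^sup>2\<close>[unfolded C_def]
  have \<Theta>0: "Theta \<delta> \<tau> D \<ge> 8 * D + 8 * \<delta>" by (simp add: Theta_def)
  then have "0 \<le> (Theta \<delta> \<tau> D + 16 * D + 16 * \<delta>) * \<delta>" using assms by auto
  then have "8 * D\<^sup>2 * \<tau> < D\<^sup>2" using small by linarith
  then have "D\<^sup>2 * (8 * \<tau>) < D\<^sup>2 * 1" by (simp add: algebra_simps)
  then have \<tau>8: "\<tau> < 1 / 8" by (subst (asm) mult_less_cancel_left) auto
  have t: "t \<le> 2 * \<tau>" "2 / 3 * \<tau> \<le> t" "0 \<le> t"
    using \<open>\<tau> > 0\<close> \<tau>8 by (auto simp: t_def field_simps)
  have \<Theta>: "4 * D * \<delta> \<le> \<tau> * (Theta \<delta> \<tau> D * \<delta>)"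
  proof (cases "\<delta> = 0")
    case False
    then have \<delta>: "\<delta> > 0" using \<open>\<delta> \<ge> 0\<close> by simp
    have le: "4 * D * min (1 / \<tau>) (2 * D / \<delta>) \<le> Theta \<delta> \<tau> D"
    proof -
      have "4 * D * min (1 / \<tau>) (2 * D / \<delta>) \<le> (4 + 8 * \<tau>) * D * min (1 / \<tau>) (2 * D / \<delta>)"
        using assms by (intro mult_right_mono) auto
      then show ?thesis using False by (simp add: Theta_def)
    qed
    show ?thesis
    proof (cases "1 / \<tau> \<le> 2 * D / \<delta>")
      case True
      then have "4 * D * (1 / \<tau>) * \<delta> \<le> Theta \<delta> \<tau> D * \<delta>"
        using le \<delta> by (intro mult_right_mono) auto
      then show ?thesis using \<open>\<tau> > 0\<close> by (simp add: field_simps)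
    next
      case F: False
      then have "4 * D * (2 * D / \<delta>) * \<delta> \<le> Theta \<delta> \<tau> D * \<delta>"
        using le \<delta> by (intro mult_right_mono) auto
      then have "8 * D\<^sup>2 \<le> Theta \<delta> \<tau> D * \<delta>" using \<delta> by (simp add: power2_eq_square)
      moreover have "0 \<le> 8 * D\<^sup>2 * \<tau>" "0 \<le> D\<^sup>2" "0 \<le> (16 * D + 16 * \<delta>) * \<delta>" using assms by auto
      moreover have "(Theta \<delta> \<tau> D + 16 * D + 16 * \<delta>) * \<delta> = Theta \<delta> \<tau> D * \<delta> + (16 * D + 16 * \<delta>) * \<delta>"
        by (simp add: algebra_simps)
      ultimately have False using small by linarith
      then show ?thesis ..
    qed
  qed simp
  have "8 * t * \<delta> * (D + \<delta>) \<le> 8 * (2 * \<tau>) * \<delta> * (D + \<delta>)"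
    using t assms by (intro mult_right_mono mult_left_mono) auto
  moreover have "t\<^sup>2 * D\<^sup>2 \<le> \<tau> * (8 * D\<^sup>2 * \<tau>)"
  proof -
    have "t\<^sup>2 * D\<^sup>2 \<le> (2 * \<tau>)\<^sup>2 * D\<^sup>2"
      using t by (intro mult_right_mono power_mono) auto
    moreover have "\<tau> * (8 * D\<^sup>2 * \<tau>) = (2 * \<tau>)\<^sup>2 * D\<^sup>2 + (2 * \<tau> * D)\<^sup>2"
      by (simp add: power2_eq_square algebra_simps)
    moreover have "0 \<le> (2 * \<tau> * D)\<^sup>2" by simp
    ultimately show ?thesis by linarith
  qed
  moreover have "2 / 3 * \<tau> * A \<le> t * A" using t A by (intro mult_right_mono) auto
  ultimately show ?thesis using \<Theta> unfolding C_def by (simp add: algebra_simps)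
qed

lemma descent_reaches_level:
  fixes a :: "nat \<Rightarrow> real"
  assumes nn: "\<And>k. a k \<ge> 0" and pos: "a 0 > 0" and \<tau>: "\<tau> > 0" and \<epsilon>: "\<epsilon> > 0"
    and step: "\<And>k. a (Suc k) \<le> a k - \<tau> * (a k - C)"
  shows "\<exists>k. real k < a 0 / (\<tau> * \<epsilon>) \<and> a k \<le> C + \<epsilon>"
proof (rule ccontr)
  assume "\<not> ?thesis"
  then have big: "a k > C + \<epsilon>" if "real k < a 0 / (\<tau> * \<epsilon>)" for k
    using that by (meson not_less)
  define N where "N = nat \<lceil>a 0 / (\<tau> * \<epsilon>)\<rceil>"
  have q: "a 0 / (\<tau> * \<epsilon>) > 0" using pos \<tau> \<epsilon> by simp
  \<comment> \<open>As \<open>N - 1\<close> is below the quotient, all of the first \<open>N\<close> steps start above the level \<open>C + \<epsilon>\<close>.\<close>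
  have N: "real N \<ge> a 0 / (\<tau> * \<epsilon>)" "real N < a 0 / (\<tau> * \<epsilon>) + 1" "N > 0"
    using q unfolding N_def by linarith+
  have dec: "a (Suc k) < a k - \<tau> * \<epsilon>" if "k < N" for k
  proof -
    have "real k + 1 \<le> real N" using that by linarith
    then have "\<epsilon> < a k - C" using big[of k] N by linarith
    then have "\<tau> * \<epsilon> < \<tau> * (a k - C)" using \<tau> by simp
    then show ?thesis using step[of k] by linarith
  qed
  have le: "a k \<le> a 0 - real k * (\<tau> * \<epsilon>)" if "k \<le> N" for k
    using that
  proof (induction k)
    case (Suc k)
    then show ?case using dec[of k] by (simp add: algebra_simps)
  qed simp
  have "a N < a 0 - real N * (\<tau> * \<epsilon>)"
    using dec[of "N - 1"] le[of "N - 1"] N(3) by (simp add: of_nat_diff algebra_simps)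
  also have "\<dots> \<le> 0" using N(1) \<tau> \<epsilon> by (simp add: field_simps)
  finally show False using nn[of N] by simp
qed

theorem theorem6p1:
  fixes \<delta> \<tau> \<epsilon> :: real
    and M :: "'w measure"
    and Z :: "nat \<Rightarrow> 'w \<Rightarrow> 'a::metric_space"
    and \<mu> :: "'a measure"
    and p s\<^sub>0 x\<^sub>0 :: 'a
    and S :: "nat \<Rightarrow> 'w \<Rightarrow> 'a"
    and \<Omega> :: "'a set"
  assumes "\<delta> \<ge> 0"
    and "geodesic_space TYPE('a)"
    and "gromov_hyperbolic TYPE('a) \<delta>"
    and "\<mu> \<in> space (prob_algebra borel)"
    and "AE z in \<mu>. z \<in> measure_support \<mu>"
    and "prob_space M"
    and "prob_space.indep_vars M (\<lambda>_. borel) Z {1..}"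
    and "\<And>i. i \<ge> 1 \<Longrightarrow> distr M borel (Z i) = \<mu>"
    and "p \<in> barycenters x\<^sub>0 \<mu>"
    and "\<tau> > 0"
    and "\<And>\<omega>. \<omega> \<in> space M \<Longrightarrow> S 0 \<omega> = s\<^sub>0"
    and "\<And>k \<omega>. \<omega> \<in> space M \<Longrightarrow>
           S (Suc k) \<omega> \<in> proximal (\<lambda>y. (dist (Z (Suc k) \<omega>) y)\<^sup>2) \<tau> (S k \<omega>)"
    and "\<And>k. S k \<in> borel_measurable (past_algebra M Z k)"
    and "bounded \<Omega>"
    and "p \<in> \<Omega>"
    and "measure_support \<mu> \<subseteq> \<Omega>"
    and "AE \<omega> in M. \<forall>k. S k \<omega> \<in> \<Omega>"
    and "\<epsilon> > 0"
  shows "\<exists>k\<^sub>0. (real k\<^sub>0 < (dist p s\<^sub>0)\<^sup>2 / (\<tau> * \<epsilon>) \<or> s\<^sub>0 = p \<and> k\<^sub>0 = 0) \<and>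
           prob_space.expectation M (\<lambda>\<omega>. (dist p (S k\<^sub>0 \<omega>))\<^sup>2)
             \<le> 8 * (diameter \<Omega>)\<^sup>2 * \<tau>
                + (Theta \<delta> \<tau> (diameter \<Omega>) + 16 * diameter \<Omega> + 16 * \<delta>) * \<delta> + \<epsilon>"
proof -
  interpret prob_space M by fact
  define D where "D = diameter \<Omega>"
  define C where "C = 8 * D\<^sup>2 * \<tau> + (Theta \<delta> \<tau> D + 16 * D + 16 * \<delta>) * \<delta>"
  define a where "a k = expectation (\<lambda>\<omega>. (dist p (S k \<omega>))\<^sup>2)" for k
  have distr: "distr M borel (Z (Suc k)) = \<mu>" for k by (rule assms(8)) simp
  have S\<Omega>: "AE \<omega> in M. S k \<omega> \<in> \<Omega>" for k
    using assms(17) by (auto elim!: eventually_mono)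
  have indep: "indep_var borel (S k) borel (Z (Suc k))" for k
    by (rule indep_var_past_algebra[OF assms(7) assms(13)])
  have a0: "a 0 = (dist p s\<^sub>0)\<^sup>2"
  proof -
    have "a 0 = expectation (\<lambda>\<omega>. (dist p s\<^sub>0)\<^sup>2)"
      unfolding a_def by (rule Bochner_Integration.integral_cong) (auto simp: assms(11))
    then show ?thesis by (simp add: prob_space)
  qed
  \<comment> \<open>a constant event of probability one on a nonempty space\<close>
  have "AE \<omega> in M. s\<^sub>0 \<in> \<Omega>"
    using S\<Omega>[of 0] AE_space by eventually_elim (simp add: assms(11))
  then have s\<^sub>0: "s\<^sub>0 \<in> \<Omega>" by simp
  have "dist p s\<^sub>0 \<le> D"
    unfolding D_def by (rule diameter_bounded_bound) (use assms s\<^sub>0 in auto)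
  then have aD: "a 0 \<le> D\<^sup>2" and D0: "D \<ge> 0"
    unfolding a0 using order_trans[OF zero_le_dist[of p s\<^sub>0]] by (auto intro: power_mono)
  have "\<exists>k\<^sub>0. (real k\<^sub>0 < a 0 / (\<tau> * \<epsilon>) \<or> s\<^sub>0 = p \<and> k\<^sub>0 = 0) \<and> a k\<^sub>0 \<le> C + \<epsilon>"
  proof (cases "D\<^sup>2 \<le> C \<or> s\<^sub>0 = p")
    case True
    \<comment> \<open>nonnegativity matters if \<open>s\<^sub>0 = p\<close>, where \<open>a 0 = 0\<close>\<close>
    have "0 \<le> C"
      unfolding C_def using assms(1,10) D0 by (auto simp: Theta_def intro!: add_nonneg_nonneg mult_nonneg_nonneg)
    then have "a 0 \<le> C + \<epsilon>" using True aD a0 assms(18) by auto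
    moreover have "s\<^sub>0 \<noteq> p \<Longrightarrow> 0 < a 0 / (\<tau> * \<epsilon>)" using a0 assms by auto
    ultimately show ?thesis by (intro exI[of _ 0]) auto
  next
    case False
    have nn: "a k \<ge> 0" for k unfolding a_def by simp
    have "a (Suc k) \<le> a k - \<tau> * (a k - C)" for k
    proof -
      have "a (Suc k) \<le> (1 - 3 / 2 * (2 * \<tau> / (1 + 2 * \<tau>))) * a k
          + 8 * (2 * \<tau> / (1 + 2 * \<tau>)) * \<delta> * (D + \<delta>) + (2 * \<tau> / (1 + 2 * \<tau>))\<^sup>2 * D\<^sup>2 + 4 * D * \<delta>"
        unfolding a_def D_def
        using assms(5,9,12,16) S\<Omega>
        by (intro expectation_proximal_step_le[OF assms(1-3) indep[of k]
              indep_var_rv1[OF indep[of "Suc k"]], of p x\<^sub>0 \<tau> \<Omega>])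
          (unfold distr, simp_all add: assms(10,14,15))
      also have "\<dots> \<le> a k - \<tau> * (a k - C)"
        unfolding C_def using assms(1,10) D0 nn[of k] False
        by (intro step_error_absorbed) (auto simp: C_def)
      finally show ?thesis .
    qed
    then show ?thesis
      using descent_reaches_level[of a \<tau> \<epsilon> C] nn a0 False assms(10,18) by auto
  qed
  then show ?thesis unfolding a0 unfolding a_def C_def D_def by simp
qed


end
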